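(* Let $T\in\mathbf{B}(H)$ be left-invertible and analytic. Then the commutant $\{T\}'=\{A\in\mathbf{B}(H): AT=TA\}$ is unitarily equivalent, via $U$, to the algebra of all generalized multipliers of $T$, i.e. $$U\{T\}'U^*=\{M_{\hat\varphi}:\hat\varphi\in\mathcal{GM}(T)\}.$$
   Context: $\mathbb{N}_0=\{0,1,2,\dots\}$. $H$ is a nonzero complex Hilbert space and $\mathbf{B}(H)$ is the algebra of bounded operators on it. $T\in\mathbf{B}(H)$ is left-invertible if $AT=I$ for some $A\in\mathbf{B}(H)$, and analytic if $\bigcap_{n=0}^\infty T^n(H)=\{0\}$. For left-invertible analytic $T$ put $\mathcal{E}=\ker T^*$, let $P_{\mathcal{E}}$ be the orthogonal projection of $H$ onto $\mathcal{E}$, $L=(T^*T)^{-1}T^*$ (the adjoint of the Cauchy dual $T'=T(T^*T)^{-1}$), $r=1/r(L)$ with $r(L)$ the spectral radius of $L$, and $\mathbb{D}_r=\{z\in\mathbb{C}:|z|<r\}$. For $f\in H$ let $(Uf)(z)=\sum_{n=0}^\infty (P_{\mathcal{E}}L^nf)z^n$, $z\in\mathbb{D}_r$; $U$ is an injective linear map from $H$ into the space of $\mathcal{E}$-valued analytic functions on $\mathbb{D}_r$ (Shimorin's model). $\mathcal{H}:=U(H)$ carries the inner product making $U\colon H\to\mathcal{H}$ unitary. For $\boldsymbol f\in\mathcal{H}$, $\hat{\boldsymbol f}(n)=P_{\mathcal{E}}L^nU^*\boldsymbol f$ ($n\in\mathbb{N}_0$) are its Taylor coefficients. For $\hat\varphi\colon\mathbb{N}_0\to\mathbf{B}(\mathcal{E})$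 and $\hat f\colon\mathbb{N}_0\to\mathcal{E}$, $(\hat\varphi*\hat f)(n)=\sum_{k=0}^n\hat\varphi(k)\hat f(n-k)$. The multiplication operator $M_{\hat\varphi}$ in $\mathcal{H}$ has domain consisting of those $\boldsymbol f\in\mathcal{H}$ for which there is (a necessarily unique) $\boldsymbol g\in\mathcal{H}$ with $\hat\varphi*\hat{\boldsymbol f}=\hat{\boldsymbol g}$, and $M_{\hat\varphi}\boldsymbol f=\boldsymbol g$. $\hat\varphi$ is a generalized multiplier of $T$ if the domain of $M_{\hat\varphi}$ is all of $\mathcal{H}$ (then $M_{\hat\varphi}\in\mathbf{B}(\mathcal{H})$). $\mathcal{GM}(T)$ is the set of all generalized multipliers of $T$. *)

theory Defs
  imports "HOL-Analysis.Analysis"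
begin

text \<open>The norm and the topology are those of the underlying real inner product space; the axiom
  \<open>inner_eq_Re_cinner\<close> makes positive definiteness of \<open>cinner\<close> and \<open>norm x = sqrt (Re (cinner x x))\<close>
  consequences of the axioms of \<^class>\<open>real_inner\<close>. The inner product is linear in its first
  argument.\<close>

class complex_hilbert = real_inner + complete_space +
  fixes scaleC :: "complex \<Rightarrow> 'a \<Rightarrow> 'a"  (infixr \<open>*\<^sub>C\<close> 75)
    and cinner :: "'a \<Rightarrow> 'a \<Rightarrow> complex"
  assumes scaleC_add_right: "a *\<^sub>C (x + y) = a *\<^sub>C x + a *\<^sub>C y"
    and scaleC_add_left: "(a + b) *\<^sub>C x = a *\<^sub>C x + b *\<^sub>C x"
    and scaleC_scaleC: "a *\<^sub>C (b *\<^sub>C x) = (a * b) *\<^sub>C x"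
    and scaleR_eq_scaleC: "r *\<^sub>R x = complex_of_real r *\<^sub>C x"
    and cinner_commute: "cinner x y = cnj (cinner y x)"
    and cinner_add_left: "cinner (x + y) z = cinner x z + cinner y z"
    and cinner_scaleC_left: "cinner (a *\<^sub>C x) y = a * cinner x y"
    and inner_eq_Re_cinner: "inner x y = Re (cinner x y)"

instantiation complex :: complex_hilbert
begin

definition scaleC_complex :: "complex \<Rightarrow> complex \<Rightarrow> complex" where
  "scaleC_complex a x = a * x"

definition cinner_complex :: "complex \<Rightarrow> complex \<Rightarrow> complex" where
  "cinner_complex x y = x * cnj y"

instance
  by standard
    (simp_all add: scaleC_complex_def cinner_complex_def algebra_simps scaleR_conv_of_real
      inner_complex_def)

end


definition bounded_operator :: "('a::complex_hilbert \<Rightarrow> 'a) \<Rightarrow> bool" where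
  "bounded_operator A \<longleftrightarrow> bounded_linear A \<and> (\<forall>c x. A (c *\<^sub>C x) = c *\<^sub>C A x)"

text \<open>The algebra \<open>\<^bold>B(E)\<close> for a subspace \<open>E\<close>. Its elements are functions on the ambient space; they are
  taken extensional, so that each operator on \<open>E\<close> has exactly one representative.\<close>

definition bounded_operators_on :: "'a::complex_hilbert set \<Rightarrow> ('a \<Rightarrow> 'a) set" where
  "bounded_operators_on E =
    {A \<in> E \<rightarrow>\<^sub>E E.
       (\<forall>x\<in>E. \<forall>y\<in>E. A (x + y) = A x + A y) \<and>
       (\<forall>c. \<forall>x\<in>E. A (c *\<^sub>C x) = c *\<^sub>C A x) \<and>
       (\<exists>K. \<forall>x\<in>E. norm (A x) \<le> K * norm x)}"

definition cadjoint :: "('a::complex_hilbert \<Rightarrow> 'a) \<Rightarrow> 'a \<Rightarrow> 'a" where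
  "cadjoint T = (THE S. \<forall>x y. cinner (T x) y = cinner x (S y))"

definition orth_proj :: "'a::complex_hilbert set \<Rightarrow> 'a \<Rightarrow> 'a" where
  "orth_proj E x = (THE y. y \<in> E \<and> (\<forall>e\<in>E. cinner (x - y) e = 0))"

definition op_spectrum :: "('a::complex_hilbert \<Rightarrow> 'a) \<Rightarrow> complex set" where
  "op_spectrum A =
    {c. \<not> (\<exists>B. bounded_operator B \<and>
              (\<forall>x. B (c *\<^sub>C x - A x) = x) \<and> (\<forall>x. c *\<^sub>C B x - A (B x) = x))}"

definition op_spectral_radius :: "('a::complex_hilbert \<Rightarrow> 'a) \<Rightarrow> real" where
  "op_spectral_radius A = (SUP c\<in>op_spectrum A. cmod c)"

definition left_invertible :: "('a::complex_hilbert \<Rightarrow> 'a) \<Rightarrow> bool" where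
  "left_invertible T \<longleftrightarrow> (\<exists>A. bounded_operator A \<and> A \<circ> T = id)"

definition analytic_operator :: "('a::complex_hilbert \<Rightarrow> 'a) \<Rightarrow> bool" where
  "analytic_operator T \<longleftrightarrow> (\<Inter>n. range (T ^^ n)) = {0}"

definition commutant :: "('a::complex_hilbert \<Rightarrow> 'a) \<Rightarrow> ('a \<Rightarrow> 'a) set" where
  "commutant T = {A. bounded_operator A \<and> A \<circ> T = T \<circ> A}"


definition coker :: "('a::complex_hilbert \<Rightarrow> 'a) \<Rightarrow> 'a set" where
  "coker T = {x. cadjoint T x = 0}"

text \<open>\<open>(T\<^sup>* T)\<^sup>-\<^sup>1 T\<^sup>*\<close>, the adjoint of the Cauchy dual \<open>T (T\<^sup>* T)\<^sup>-\<^sup>1\<close>; for left-invertible \<open>T\<close> the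
  map \<open>T\<^sup>* T\<close> is bijective, so that \<open>inv\<close> is its inverse.\<close>

definition cdual_adj :: "('a::complex_hilbert \<Rightarrow> 'a) \<Rightarrow> 'a \<Rightarrow> 'a" where
  "cdual_adj T = inv (cadjoint T \<circ> T) \<circ> cadjoint T"

definition model_radius :: "('a::complex_hilbert \<Rightarrow> 'a) \<Rightarrow> real" where
  "model_radius T = 1 / op_spectral_radius (cdual_adj T)"

definition model_map :: "('a::complex_hilbert \<Rightarrow> 'a) \<Rightarrow> 'a \<Rightarrow> complex \<Rightarrow> 'a" where
  "model_map T f =
    (\<lambda>z\<in>ball 0 (model_radius T). \<Sum>n. z ^ n *\<^sub>C orth_proj (coker T) ((cdual_adj T ^^ n) f))"

definition model_space :: "('a::complex_hilbert \<Rightarrow> 'a) \<Rightarrow> (complex \<Rightarrow> 'a) set" where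
  "model_space T = range (model_map T)"

definition model_cinner ::
    "('a::complex_hilbert \<Rightarrow> 'a) \<Rightarrow> (complex \<Rightarrow> 'a) \<Rightarrow> (complex \<Rightarrow> 'a) \<Rightarrow> complex" where
  "model_cinner T f g = cinner (inv (model_map T) f) (inv (model_map T) g)"

text \<open>The Hilbert space adjoint \<open>U\<^sup>*\<close> of the unitary \<open>U\<close> = \<open>model_map T\<close>, for arguments in the model
  space.\<close>

definition model_map_adj :: "('a::complex_hilbert \<Rightarrow> 'a) \<Rightarrow> (complex \<Rightarrow> 'a) \<Rightarrow> 'a" where
  "model_map_adj T g = (THE f. \<forall>h. cinner h f = model_cinner T (model_map T h) g)"

definition taylor_coeff :: "('a::complex_hilbert \<Rightarrow> 'a) \<Rightarrow> (complex \<Rightarrow> 'a) \<Rightarrow> nat \<Rightarrow> 'a" where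
  "taylor_coeff T f n = orth_proj (coker T) ((cdual_adj T ^^ n) (model_map_adj T f))"


definition cauchy_conv :: "(nat \<Rightarrow> 'a \<Rightarrow> 'a) \<Rightarrow> (nat \<Rightarrow> 'a) \<Rightarrow> nat \<Rightarrow> 'a::comm_monoid_add" where
  "cauchy_conv \<phi> f n = (\<Sum>k\<le>n. \<phi> k (f (n - k)))"

definition mult_dom ::
    "('a::complex_hilbert \<Rightarrow> 'a) \<Rightarrow> (nat \<Rightarrow> 'a \<Rightarrow> 'a) \<Rightarrow> (complex \<Rightarrow> 'a) set" where
  "mult_dom T \<phi> =
    {f \<in> model_space T. \<exists>g\<in>model_space T. cauchy_conv \<phi> (taylor_coeff T f) = taylor_coeff T g}"

text \<open>Operators in the model space are extensional functions on their domains.\<close>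

definition mult_op ::
    "('a::complex_hilbert \<Rightarrow> 'a) \<Rightarrow> (nat \<Rightarrow> 'a \<Rightarrow> 'a) \<Rightarrow> (complex \<Rightarrow> 'a) \<Rightarrow> complex \<Rightarrow> 'a" where
  "mult_op T \<phi> =
    (\<lambda>f\<in>mult_dom T \<phi>.
       THE g. g \<in> model_space T \<and> cauchy_conv \<phi> (taylor_coeff T f) = taylor_coeff T g)"

definition gen_multipliers :: "('a::complex_hilbert \<Rightarrow> 'a) \<Rightarrow> (nat \<Rightarrow> 'a \<Rightarrow> 'a) set" where
  "gen_multipliers T =
    {\<phi>. (\<forall>n. \<phi> n \<in> bounded_operators_on (coker T)) \<and> mult_dom T \<phi> = model_space T}"

end

theory Submission
  imports Defs
begin

text \<open>
  Write \<open>P\<close> for the projection onto \<open>E = ker T\<^sup>*\<close>. Then \<open>L T = I\<close> and \<open>P = I - T L\<close>, so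
  \<open>f = P f + T L f\<close>, and analyticity makes \<open>f\<close> determined by the coefficients \<open>P L\<^sup>n f\<close>.
  If \<open>A\<close> commutes with \<open>T\<close>, then \<open>A f = A P f + T A L f\<close>; by induction the coefficients of \<open>A f\<close> are the
  convolution of those of \<open>f\<close> with \<open>\<phi>(n) = P L\<^sup>n A|\<^sub>E\<close>. Conversely, an everywhere defined multiplier
  yields a linear map \<open>A\<close> all of whose coefficients \<open>P L\<^sup>n A\<close> are bounded, hence \<open>A\<close> is bounded by a closed
  graph argument; it commutes with \<open>T\<close> because \<open>T\<close> acts on the coefficients as the right shift.
\<close>

subsection \<open>Real Hilbert spaces\<close>

text \<open>If \<open>x - p\<close> had a nonzero component along \<open>s\<close>, moving
  \<open>p\<close> inside \<open>S\<close> would bring it closer to \<open>x\<close>.\<close>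

lemma nearest_point_orthogonal:
  fixes p x :: "'a::real_inner"
  assumes S: "subspace S" "p \<in> S" and min: "\<And>s. s \<in> S \<Longrightarrow> norm (x - p) \<le> norm (x - s)"
    and "s \<in> S"
  shows "inner (x - p) s = 0"
proof (cases "s = 0")
  case False
  define w where "w = x - p"
  \<comment> \<open>This \<open>t\<close> minimises the norm of
    \<open>w - t *\<^sub>R s\<close>.\<close>
  define t where "t = inner w s / inner s s"
  have ss: "inner s s > 0" using False by simp
  have "p + t *\<^sub>R s \<in> S" using S \<open>s \<in> S\<close> by (simp add: subspace_add subspace_mul)
  from min[OF this] have "norm w \<le> norm (w - t *\<^sub>R s)" by (simp add: w_def algebra_simps)
  then have "inner w w \<le> inner (w - t *\<^sub>R s) (w - t *\<^sub>R s)" by (simp add: norm_le)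
  also have "\<dots> = inner w w - 2 * t * inner w s + t * t * inner s s"
    by (simp add: inner_diff inner_commute algebra_simps)
  also have "t * t * inner s s = t * inner w s" using ss by (simp add: t_def)
  finally have "t * inner w s \<le> 0" by simp
  then have "inner w s * inner w s / inner s s \<le> 0" by (simp add: t_def)
  then have "inner w s * inner w s \<le> 0" using ss by (simp add: divide_le_0_iff)
  then have "inner w s = 0" by (metis mult_le_0_iff order_antisym_conv linorder_linear)
  then show ?thesis by (simp add: w_def)
qed simp

text \<open>A sequence in \<open>S\<close> whose distances to \<open>x\<close> tend to the infimum
  is Cauchy by the parallelogram law; its limit is a nearest point.\<close>

lemma orthogonal_projection_exists:
  fixes S :: "'a::{real_inner,complete_space} set"
  assumes S: "subspace S" "closed S"
  obtains p where "p \<in> S" "\<And>s. s \<in> S \<Longrightarrow> inner (x - p) s = 0"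
proof -
  define d where "d = infdist x S"
  have ne: "S \<noteq> {}" using S subspace_0 by auto
  have d_le: "d \<le> norm (x - s)" if "s \<in> S" for s
    using infdist_le[OF that, of x] by (simp add: d_def dist_norm)
  have d0: "d \<ge> 0" by (simp add: d_def infdist_nonneg)
  have "\<exists>s\<in>S. norm (x - s) < d + e" if "e > 0" for e
    using cInf_lessD[of "dist x ` S" "d + e"] that ne
    by (auto simp: d_def infdist_notempty dist_norm)
  then have "\<forall>n::nat. \<exists>s\<in>S. norm (x - s) < d + 1 / Suc n"
    by simp
  then obtain p where p: "\<And>n. p n \<in> S" "\<And>n. norm (x - p n) < d + 1 / real (Suc n)"
    by metis
  have inv0: "(\<lambda>n. 1 / real (Suc n)) \<longlonglongrightarrow> 0" using LIMSEQ_Suc[OF lim_1_over_n] by simp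
  define u where "u n = (d + 1 / real (Suc n))\<^sup>2 - d\<^sup>2" for n
  have "(norm (x - p n))\<^sup>2 \<le> (d + 1 / real (Suc n))\<^sup>2" for n
    using p(2)[of n] by (intro power_mono) auto
  then have nsq: "(norm (x - p n))\<^sup>2 \<le> d\<^sup>2 + u n" for n by (simp add: u_def)
  \<comment> \<open>Parallelogram law for \<open>x - p m\<close> and \<open>x - p n\<close>: the
    midpoint \<open>q\<close> lies in \<open>S\<close>, so its distance to \<open>x\<close> is at
    least \<open>d\<close>.\<close>
  have par: "(norm (p m - p n))\<^sup>2 \<le> 2 * u m + 2 * u n" for m n
  proof -
    define q where "q = (1/2) *\<^sub>R (p m + p n)"
    have "q \<in> S" using p S by (simp add: q_def subspace_add subspace_mul)
    then have "d\<^sup>2 \<le> (norm (x - q))\<^sup>2" using d_le d0 by (intro power_mono) auto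
    moreover have "(norm (p m - p n))\<^sup>2
        = 2 * (norm (x - p m))\<^sup>2 + 2 * (norm (x - p n))\<^sup>2 - 4 * (norm (x - q))\<^sup>2"
      by (simp add: q_def power2_norm_eq_inner inner_diff inner_add inner_commute field_simps)
    ultimately show ?thesis using nsq[of m] nsq[of n] by linarith
  qed
  have "Cauchy p"
  proof (rule metric_CauchyI)
    fix e :: real assume e: "e > 0"
    have "u \<longlonglongrightarrow> (d + 0)\<^sup>2 - d\<^sup>2"
      unfolding u_def by (intro tendsto_intros inv0)
    then have "\<forall>\<^sub>F n in sequentially. u n < e\<^sup>2 / 4"
      using e by (intro order_tendstoD) auto
    then obtain N where N: "\<And>n. n \<ge> N \<Longrightarrow> u n < e\<^sup>2 / 4"
      by (auto simp: eventually_sequentially)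
    have "dist (p m) (p n) < e" if "m \<ge> N" "n \<ge> N" for m n
    proof -
      have "(norm (p m - p n))\<^sup>2 < e\<^sup>2" using par[of m n] N[OF that(1)] N[OF that(2)] by linarith
      then show ?thesis using e by (simp add: dist_norm power2_less_imp_less)
    qed
    then show "\<exists>M. \<forall>m\<ge>M. \<forall>n\<ge>M. dist (p m) (p n) < e" by blast
  qed
  then obtain q where q: "p \<longlonglongrightarrow> q" by (auto simp: Cauchy_convergent_iff convergent_def)
  have qS: "q \<in> S" using closed_sequentially[OF S(2)] p(1) q by blast
  have "(\<lambda>n. norm (x - p n)) \<longlonglongrightarrow> norm (x - q)" by (intro tendsto_intros q)
  moreover have "(\<lambda>n. d + 1 / real (Suc n)) \<longlonglongrightarrow> d + 0" by (intro tendsto_intros inv0)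
  ultimately have "norm (x - q) \<le> d + 0"
    by (rule LIMSEQ_le) (use p(2) in \<open>meson less_imp_le\<close>)
  then have "norm (x - q) \<le> norm (x - s)" if "s \<in> S" for s using d_le[OF that] by simp
  from that[OF qS] nearest_point_orthogonal[OF S(1) qS this] show thesis by blast
qed

text \<open>The kernel of a nonzero \<open>f\<close> is a closed hyperplane, so a vector
  \<open>w\<close> orthogonal to it represents \<open>f\<close> up to a factor.\<close>

lemma riesz_representation:
  fixes f :: "'a::{real_inner,complete_space} \<Rightarrow> real"
  assumes "bounded_linear f"
  obtains y where "\<And>x. f x = inner x y"
proof (cases "\<forall>x. f x = 0")
  case True
  then show thesis using that[of 0] by simp
next
  case False
  then obtain z where z: "f z \<noteq> 0" by blast
  interpret f: bounded_linear f by fact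
  let ?K = "{x. f x = 0}"
  have "subspace ?K" by (auto simp: subspace_def f.add f.scaleR)
  moreover have "closed ?K"
    by (intro closed_Collect_eq continuous_intros f.continuous_on)
  ultimately obtain p where p: "p \<in> ?K" "\<And>s. s \<in> ?K \<Longrightarrow> inner (z - p) s = 0"
    using orthogonal_projection_exists by blast
  define w where "w = z - p"
  have fw: "f w = f z" "f w \<noteq> 0" using p(1) z by (auto simp: w_def f.diff)
  then have w0: "inner w w \<noteq> 0" using f.zero by force
  have "f x = inner x ((f w / inner w w) *\<^sub>R w)" for x
  proof -
    \<comment> \<open>Subtracting this multiple of \<open>w\<close> puts \<open>x\<close> in the
      kernel.\<close>
    have "inner w (x - (f x / f w) *\<^sub>R w) = 0"
      unfolding w_def by (rule p(2)) (use fw in \<open>simp add: f.diff f.scaleR f.zero flip: w_def\<close>)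
    then have "inner w x = f x / f w * inner w w" by (simp add: inner_diff)
    then show ?thesis using fw w0 by (simp add: inner_commute)
  qed
  then show thesis by (rule that)
qed

lemma real_adjoint_exists:
  fixes T :: "'a::{real_inner,complete_space} \<Rightarrow> 'a"
  assumes "bounded_linear T"
  shows "\<exists>S. \<forall>x y. inner (T x) y = inner x (S y)"
proof -
  have "\<exists>z. \<forall>x. inner (T x) y = inner x z" for y
    using riesz_representation[OF bounded_linear_compose[OF bounded_linear_inner_left assms]] by metis
  then show ?thesis by metis
qed

text \<open>The inequality is a closed condition on \<open>y\<close>, so it extends to
  \<open>y = w\<close>.\<close>

lemma norm_le_if_inner_le_on_dense:
  fixes w :: "'a::real_inner"
  assumes dense: "closure D = UNIV" and le: "\<And>y. y \<in> D \<Longrightarrow> inner y w \<le> K * norm y"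
    and "K \<ge> 0"
  shows "norm w \<le> K"
proof -
  have "closed {y. inner y w \<le> K * norm y}"
    by (intro closed_Collect_le continuous_intros)
  then have "closure D \<subseteq> {y. inner y w \<le> K * norm y}"
    using le by (intro closure_minimal) auto
  then have "inner w w \<le> K * norm w" using dense by auto
  then have "norm w * norm w \<le> K * norm w" by (simp add: dot_square_norm power2_eq_square)
  then show ?thesis using \<open>K \<ge> 0\<close> by (cases "w = 0") auto
qed

section \<open>Boundedness criteria for linear maps\<close>

lemma bounded_linear_if_bounded_on_ball:
  fixes A :: "'a::real_normed_vector \<Rightarrow> 'b::real_normed_vector"
  assumes "linear A" and "e > 0" and K: "\<And>x. x \<in> ball x0 e \<Longrightarrow> norm (A x) \<le> K"
  shows "bounded_linear A"
proof -
  interpret linear A by fact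
  have "norm (A x) \<le> norm x * (4 * K / e)" for x
  proof (cases "x = 0")
    case False
    \<comment> \<open>\<open>c *\<^sub>R x\<close> has norm \<open>e / 2\<close>, so
      \<open>x0 + c *\<^sub>R x\<close> stays in the ball; \<open>A (c *\<^sub>R x)\<close> is a
      difference of two values there.\<close>
    define c where "c = e / (2 * norm x)"
    have c: "c > 0" using False \<open>e > 0\<close> by (simp add: c_def)
    have "norm (A (x0 + c *\<^sub>R x)) \<le> K" "norm (A x0) \<le> K"
      using False \<open>e > 0\<close> by (auto intro!: K simp: dist_norm c_def)
    then have "norm (A (c *\<^sub>R x)) \<le> 2 * K"
      using norm_triangle_ineq4[of "A (x0 + c *\<^sub>R x)" "A x0"] by (simp add: add)
    then have "c * norm (A x) \<le> 2 * K" using c by (simp add: scale)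
    then show ?thesis using False \<open>e > 0\<close> by (simp add: c_def field_simps)
  qed (simp add: zero)
  then show ?thesis by (rule bounded_linear_intro[OF add scale])
qed

lemma real_subspace_closure:
  fixes S :: "'a::real_normed_vector set"
  assumes S: "subspace S"
  shows "subspace (closure S)"
  unfolding subspace_def
proof (intro conjI ballI allI)
  show "0 \<in> closure S" using subspace_0[OF S] closure_subset by blast
next
  fix x y assume "x \<in> closure S" "y \<in> closure S"
  then obtain f g where "\<And>n. f n \<in> S" "f \<longlonglongrightarrow> x" "\<And>n. g n \<in> S" "g \<longlonglongrightarrow> y"
    unfolding closure_sequential by blast
  then have "(\<forall>n. f n + g n \<in> S) \<and> (\<lambda>n. f n + g n) \<longlonglongrightarrow> x + y"
    by (simp add: subspace_add[OF S] tendsto_add)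
  then show "x + y \<in> closure S"
    unfolding closure_sequential by (intro exI[of _ "\<lambda>n. f n + g n"])
next
  fix c :: real and x assume "x \<in> closure S"
  then obtain f where "\<And>n. f n \<in> S" "f \<longlonglongrightarrow> x"
    unfolding closure_sequential by blast
  then have "(\<forall>n. c *\<^sub>R f n \<in> S) \<and> (\<lambda>n. c *\<^sub>R f n) \<longlonglongrightarrow> c *\<^sub>R x"
    by (simp add: subspace_mul[OF S] tendsto_scaleR)
  then show "c *\<^sub>R x \<in> closure S"
    unfolding closure_sequential by (intro exI[of _ "\<lambda>n. c *\<^sub>R f n"])
qed

text \<open>A form of the closed graph theorem. The separation hypothesis makes the set of all \<open>y\<close> for
  which \<open>x \<mapsto> \<langle>y, A x\<rangle>\<close> is bounded dense, so the sets \<open>{x. \<parallel>A x\<parallel> \<le> k}\<close> are closed and Baire's theorem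
  applies to them.\<close>

lemma bounded_linear_if_separating_compositions_bounded:
  fixes A :: "'a::{real_normed_vector,complete_space} \<Rightarrow> 'b::{real_inner,complete_space}"
    and B :: "'i \<Rightarrow> 'b \<Rightarrow> 'c::real_inner"
  assumes A: "linear A" and B: "\<And>i. bounded_linear (B i)"
    and BA: "\<And>i. bounded_linear (\<lambda>x. B i (A x))"
    and sep: "\<And>w. (\<And>i. B i w = 0) \<Longrightarrow> w = 0"
  shows "bounded_linear A"
proof -
  define D where "D = {y. bounded_linear (\<lambda>x. inner y (A x))}"
  have "subspace D"
    unfolding subspace_def D_def
    by (auto simp: inner_add_left intro: bounded_linear_add bounded_linear_const_mult
        bounded_linear_zero)
  then have cD: "subspace (closure D)" by (rule real_subspace_closure)
  have "w \<in> closure D" for w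
  proof -
    \<comment> \<open>Density amounts to \<open>w - p = 0\<close>; by separation it is enough that
      each \<open>B i\<close> kills this residual.\<close>
    obtain p where p: "p \<in> closure D" "\<And>s. s \<in> closure D \<Longrightarrow> inner (w - p) s = 0"
      using orthogonal_projection_exists[OF cD closed_closure] by blast
    have "inner (B i (w - p)) v = 0" for i v
    proof -
      \<comment> \<open>\<open>y\<close> is the adjoint of \<open>B i\<close> applied to
        \<open>v\<close>; it lies in \<open>D\<close> because \<open>B i\<close> composed with
        \<open>A\<close> is bounded.\<close>
      obtain y where y: "\<And>u. inner (B i u) v = inner u y"
        using riesz_representation[OF bounded_linear_compose[OF bounded_linear_inner_left B]] by blast
      have "bounded_linear (\<lambda>x. inner (B i (A x)) v)"
        by (rule bounded_linear_compose[OF bounded_linear_inner_left BA])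
      then have "y \<in> D" unfolding D_def y by (simp add: inner_commute)
      then show ?thesis using p(2) closure_subset y by auto
    qed
    then have "w - p = 0" by (intro sep) (metis inner_eq_zero_iff)
    then show ?thesis using p(1) by simp
  qed
  then have dense: "closure D = UNIV" by blast
  define F where "F k = {x. norm (A x) \<le> real k}" for k
  have F_closed: "closed (F k)" for k
  proof -
    \<comment> \<open>Testing against the dense set \<open>D\<close> suffices for the norm bound,
      and for \<open>y\<close> in \<open>D\<close> each test is a closed condition on
      \<open>x\<close>.\<close>
    have "F k = (\<Inter>y\<in>D. {x. inner y (A x) \<le> real k * norm y})"
    proof (intro set_eqI iffI)
      fix x assume x: "x \<in> F k"
      have "inner y (A x) \<le> real k * norm y" for y
      proof -
        have "inner y (A x) \<le> norm (A x) * norm y"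
          using norm_cauchy_schwarz[of y "A x"] by (simp add: mult.commute)
        also have "\<dots> \<le> real k * norm y" using x by (intro mult_right_mono) (auto simp: F_def)
        finally show ?thesis .
      qed
      then show "x \<in> (\<Inter>y\<in>D. {x. inner y (A x) \<le> real k * norm y})" by blast
    qed (auto simp: F_def intro: norm_le_if_inner_le_on_dense[OF dense])
    moreover have "closed {x. inner y (A x) \<le> real k * norm y}" if "y \<in> D" for y
      using that by (intro closed_Collect_le continuous_intros linear_continuous_on) (simp add: D_def)
    ultimately show ?thesis by auto
  qed
  have "\<exists>k. interior (F k) \<noteq> {}"
  proof (rule ccontr)
    assume "\<not> ?thesis"
    \<comment> \<open>Baire: a countable union of closed sets with empty interior has empty
      interior, yet the sets \<open>F k\<close> exhaust the space.\<close>
    then have "Met_TC.mtopology interior_of \<Union>(range F) = ({} :: 'a set)"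
      using F_closed
      by (intro Met_TC.metric_Baire_category_alt) (auto simp: complete_UNIV)
    moreover have "\<Union>(range F) = UNIV"
      using real_arch_simple unfolding F_def by blast
    ultimately show False by simp
  qed
  then obtain k x0 where "x0 \<in> interior (F k)" by blast
  then obtain e where "e > 0" "ball x0 e \<subseteq> F k" unfolding mem_interior by blast
  then show ?thesis
    by (intro bounded_linear_if_bounded_on_ball[OF A, of e x0 "real k"]) (auto simp: F_def)
qed

section \<open>Identity theorem for power series\<close>

lemma powser_sums_zero_imp_coeff_zero:
  fixes a :: "nat \<Rightarrow> 'a::{real_normed_field,banach}"
  assumes "s > 0" and "\<And>t. t \<noteq> 0 \<Longrightarrow> norm t < s \<Longrightarrow> (\<lambda>n. a n * t ^ n) sums 0"
  shows "a n = 0"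
  using assms(2)
proof (induction n arbitrary: a)
  case (0 a)
  show ?case
    using powser_limit_0_strong[of s a "\<lambda>_. 0", OF \<open>s > 0\<close> 0] by (simp add: tendsto_const_iff)
next
  case (Suc n a)
  have a0: "a 0 = 0"
    using powser_limit_0_strong[of s a "\<lambda>_. 0", OF \<open>s > 0\<close> Suc.prems]
    by (simp add: tendsto_const_iff)
  \<comment> \<open>With the constant term gone, division by \<open>t\<close> shifts the
    coefficients down by one; hence the restriction to \<open>t \<noteq> 0\<close>.\<close>
  have "(\<lambda>n. a (Suc n) * t ^ n) sums 0" if "t \<noteq> 0" "norm t < s" for t
  proof -
    have "(\<lambda>n. a (Suc n) * t ^ Suc n) sums 0"
      using Suc.prems[OF that] a0 by (subst sums_Suc_iff) simp
    from sums_mult[OF this, of "inverse t"] show ?thesis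
      using that by (simp add: field_simps)
  qed
  then show ?case by (rule Suc.IH)
qed

subsection \<open>Operators on complex Hilbert spaces\<close>

instance complex_hilbert \<subseteq> banach ..

lemma scaleC_zero_left [simp]: "0 *\<^sub>C x = 0"
  using scaleR_eq_scaleC[of 0 x] by simp

lemma scaleC_zero_right [simp]: "a *\<^sub>C (0::'a::complex_hilbert) = 0"
  using scaleC_add_right[of a 0 "0::'a"] by simp

lemma scaleC_one [simp]: "1 *\<^sub>C x = x"
  using scaleR_eq_scaleC[of 1 x] by simp

lemma scaleC_minus_right: "a *\<^sub>C (- x) = - (a *\<^sub>C (x::'a::complex_hilbert))"
  using scaleC_add_right[of a x "- x"] by (simp add: eq_neg_iff_add_eq_0 add.commute)

lemma scaleC_diff_right: "a *\<^sub>C (x - y) = a *\<^sub>C x - a *\<^sub>C (y::'a::complex_hilbert)"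
  using scaleC_add_right[of a x "- y"] by (simp add: scaleC_minus_right)

lemma scaleC_sum: "c *\<^sub>C sum g I = (\<Sum>i\<in>I. c *\<^sub>C (g i :: 'a::complex_hilbert))"
  by (induction I rule: infinite_finite_induct) (simp_all add: scaleC_add_right)

lemma cinner_add_right: "cinner x (y + z) = cinner x y + cinner x (z::'a::complex_hilbert)"
  by (metis cinner_add_left cinner_commute complex_cnj_add)

lemma cinner_scaleC_right: "cinner x (a *\<^sub>C y) = cnj a * cinner x (y::'a::complex_hilbert)"
  by (metis cinner_scaleC_left cinner_commute complex_cnj_mult)

text \<open>Since \<open>Im z = - Re (\<i> * z)\<close>, the real inner product determines the
  complex one.\<close>

lemma cinner_eq_inner: "cinner x y = Complex (inner x y) (- inner (\<i> *\<^sub>C x) (y::'a::complex_hilbert))"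
  by (simp add: complex_eq_iff inner_eq_Re_cinner cinner_scaleC_left)

lemma cinner_zero_right [simp]: "cinner (x::'a::complex_hilbert) 0 = 0"
  by (simp add: cinner_eq_inner zero_complex.ctr)

lemma cinner_diff_left: "cinner (x - y) z = cinner x z - cinner y (z::'a::complex_hilbert)"
  using cinner_add_left[of "x - y" y z] by simp

lemma cinner_diff_right: "cinner z (x - y) = cinner z x - cinner z (y::'a::complex_hilbert)"
  using cinner_add_right[of z "x - y" y] by simp

lemma cinner_right_eqI:
  fixes y z :: "'a::complex_hilbert"
  assumes "\<And>x. cinner x y = cinner x z"
  shows "y = z"
proof -
  have "inner (y - z) (y - z) = 0"
    by (simp add: inner_eq_Re_cinner cinner_diff_right assms)
  then show ?thesis by simp
qed

lemma cinner_self_eq_zeroD: "cinner x x = 0 \<Longrightarrow> x = (0::'a::complex_hilbert)"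
  using inner_eq_Re_cinner[of x x] by simp

lemma norm_scaleC: "norm (a *\<^sub>C x) = cmod a * norm (x::'a::complex_hilbert)"
proof -
  have "cinner (a *\<^sub>C x) (a *\<^sub>C x) = complex_of_real ((cmod a)\<^sup>2) * cinner x x"
    unfolding complex_norm_square cinner_scaleC_left cinner_scaleC_right by (simp only: ac_simps)
  then have "(norm (a *\<^sub>C x))\<^sup>2 = (cmod a * norm x)\<^sup>2"
    unfolding power_mult_distrib power2_norm_eq_inner inner_eq_Re_cinner by simp
  then show ?thesis by (simp add: power2_eq_iff_nonneg)
qed

text \<open>The real adjoint is also the complex one because \<open>T\<close> commutes with
  multiplication by \<open>\<i>\<close>; uniqueness makes the description in \<open>cadjoint\<close>
  meaningful.\<close>

lemma cadjoint:
  fixes T :: "'a::complex_hilbert \<Rightarrow> 'a"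
  assumes T: "bounded_operator T"
  shows "cinner (T x) y = cinner x (cadjoint T y)"
proof -
  have bl: "bounded_linear T" and sc: "\<And>c x. T (c *\<^sub>C x) = c *\<^sub>C T x"
    using T by (simp_all add: bounded_operator_def)
  obtain S where S: "\<And>x y. inner (T x) y = inner x (S y)"
    using real_adjoint_exists[OF bl] by blast
  have S': "\<forall>x y. cinner (T x) y = cinner x (S y)"
    unfolding cinner_eq_inner S[symmetric] sc by simp
  have "cadjoint T = S"
    unfolding cadjoint_def
  proof (rule the_equality)
    show "\<forall>x y. cinner (T x) y = cinner x (S y)" by fact
  next
    fix R assume "\<forall>x y. cinner (T x) y = cinner x (R y)"
    with S' have "cinner x (R y) = cinner x (S y)" for x y by metis
    then have "R y = S y" for y by (rule cinner_right_eqI)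
    then show "R = S" by blast
  qed
  then show ?thesis using S' by simp
qed

lemma bounded_operatorD:
  assumes "bounded_operator A"
  shows "bounded_linear A" "A (x + y) = A x + A y" "A (x - y) = A x - A y" "A 0 = 0"
    "A (c *\<^sub>C x) = c *\<^sub>C A x"
  using assms unfolding bounded_operator_def
  by (auto simp: linear_simps)

lemma bounded_operatorI:
  fixes A :: "'a::complex_hilbert \<Rightarrow> 'a"
  assumes "\<And>x y. A (x + y) = A x + A y" "\<And>c x. A (c *\<^sub>C x) = c *\<^sub>C A x"
    and "\<And>x. norm (A x) \<le> norm x * K"
  shows "bounded_operator A"
  unfolding bounded_operator_def
  using assms by (auto intro!: bounded_linear_intro[of A K] simp: scaleR_eq_scaleC)

section \<open>The resolvent equation and the size of the spectrum\<close>

lemma resolvent_equation_unique_solution: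
  fixes A :: "'a::complex_hilbert \<Rightarrow> 'a"
  assumes A: "bounded_operator A" and K: "\<And>x. norm (A x) \<le> norm x * K" "0 \<le> K" "K < cmod c"
  shows "\<exists>!x. c *\<^sub>C x - A x = y"
proof -
  have c: "c \<noteq> 0" using K by auto
  \<comment> \<open>The equation is the fixed-point equation of \<open>?g\<close>, a contraction
    with constant \<open>K / cmod c < 1\<close>.\<close>
  let ?g = "\<lambda>x. inverse c *\<^sub>C (y + A x)"
  have eq: "?g x = x \<longleftrightarrow> c *\<^sub>C x - A x = y" for x
  proof
    assume "?g x = x"
    then have "c *\<^sub>C ?g x = c *\<^sub>C x" by simp
    then show "c *\<^sub>C x - A x = y" using c by (simp add: scaleC_scaleC algebra_simps)
  next
    assume "c *\<^sub>C x - A x = y"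
    then have "y + A x = c *\<^sub>C x" by (simp add: algebra_simps)
    then show "?g x = x" using c by (simp add: scaleC_scaleC)
  qed
  have "dist (?g x) (?g x') \<le> K / cmod c * dist x x'" for x x'
  proof -
    have "?g x - ?g x' = inverse c *\<^sub>C A (x - x')"
      by (simp add: bounded_operatorD[OF A] flip: scaleC_diff_right)
    then show ?thesis
      using mult_left_mono[OF K(1)[of "x - x'"], of "inverse (cmod c)"]
      by (simp add: dist_norm norm_scaleC norm_inverse divide_inverse mult_ac)
  qed
  then have "\<exists>!x. ?g x = x"
    using K by (intro banach_fix_type[of "K / cmod c"]) (simp_all add: divide_less_eq)
  then show ?thesis by (simp add: eq)
qed

text \<open>For \<open>cmod c > K\<close> the unique solutions of the resolvent equation define a
  bounded inverse. This bounds the spectrum, so that its supremum is a genuine upper bound.\<close>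

lemma norm_le_if_in_op_spectrum:
  fixes A :: "'a::complex_hilbert \<Rightarrow> 'a"
  assumes A: "bounded_operator A" and K: "\<And>x. norm (A x) \<le> norm x * K" "0 \<le> K"
    and c: "c \<in> op_spectrum A"
  shows "cmod c \<le> K"
proof (rule ccontr)
  assume "\<not> cmod c \<le> K"
  then have Kc: "K < cmod c" by simp
  note ex1 = resolvent_equation_unique_solution[OF A K Kc]
  define B where "B y = (THE x. c *\<^sub>C x - A x = y)" for y
  have B: "c *\<^sub>C B y - A (B y) = y" for y
    unfolding B_def by (rule theI'[OF ex1])
  have B_eqI: "B y = x" if "c *\<^sub>C x - A x = y" for x y
    using ex1 B that by metis
  have B_left: "B (c *\<^sub>C x - A x) = x" for x
    by (rule B_eqI) simp
  have "bounded_operator B"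
  proof (rule bounded_operatorI)
    show "B (x + y) = B x + B y" for x y
    proof (rule B_eqI)
      show "c *\<^sub>C (B x + B y) - A (B x + B y) = x + y"
        using B[of x] B[of y] by (simp add: bounded_operatorD[OF A] scaleC_add_right algebra_simps)
    qed
    show "B (a *\<^sub>C x) = a *\<^sub>C B x" for a x
    proof (rule B_eqI)
      have "c *\<^sub>C a *\<^sub>C B x - A (a *\<^sub>C B x) = a *\<^sub>C (c *\<^sub>C B x - A (B x))"
        by (simp add: bounded_operatorD[OF A] scaleC_scaleC scaleC_diff_right mult.commute)
      then show "c *\<^sub>C a *\<^sub>C B x - A (a *\<^sub>C B x) = a *\<^sub>C x" by (simp add: B)
    qed
    show "norm (B y) \<le> norm y * (1 / (cmod c - K))" for y
    proof -
      have "cmod c * norm (B y) = norm (y + A (B y))"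
        using B[of y] by (metis norm_scaleC diff_add_cancel)
      also have "\<dots> \<le> norm y + norm (B y) * K"
        using norm_triangle_ineq[of y "A (B y)"] K(1)[of "B y"] by linarith
      finally show ?thesis using Kc by (simp add: field_simps)
    qed
  qed
  then show False
    using c B B_left unfolding op_spectrum_def by blast
qed

subsection \<open>The Cauchy dual of a left-invertible operator\<close>

locale left_invertible_operator =
  fixes T :: "'a::complex_hilbert \<Rightarrow> 'a"
  assumes bounded: "bounded_operator T"
    and left_inv: "left_invertible T"
begin

abbreviation "L \<equiv> cdual_adj T"
abbreviation "Tadj \<equiv> cadjoint T"
abbreviation "P \<equiv> orth_proj (coker T)"

lemmas T_simps = bounded_operatorD(2-5)[OF bounded]

lemma Tadj_add: "Tadj (x + y) = Tadj x + Tadj y"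
  by (rule cinner_right_eqI) (simp add: cinner_add_right flip: cadjoint[OF bounded])

lemma Tadj_diff: "Tadj (x - y) = Tadj x - Tadj y"
  by (rule cinner_right_eqI) (simp add: cinner_diff_right flip: cadjoint[OF bounded])

lemma Tadj_zero: "Tadj 0 = 0"
  using Tadj_diff[of 0 0] by simp

lemma Tadj_scaleC: "Tadj (a *\<^sub>C x) = a *\<^sub>C Tadj x"
  by (rule cinner_right_eqI) (simp add: cinner_scaleC_right flip: cadjoint[OF bounded])

lemma coker_orthogonal_range: "e \<in> coker T \<Longrightarrow> cinner (T x) e = 0"
  by (simp add: coker_def cadjoint[OF bounded])

text \<open>\<open>Tadj (T d) = 0\<close> gives \<open>cinner (T d) (T d) = 0\<close>, and a left
  inverse makes \<open>T\<close> injective.\<close>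

lemma inj_TadjT: "Tadj (T x) = Tadj (T y) \<Longrightarrow> x = y"
proof -
  assume "Tadj (T x) = Tadj (T y)"
  then have "Tadj (T (x - y)) = 0" by (simp add: T_simps Tadj_diff)
  then have "cinner (T (x - y)) (T (x - y)) = 0"
    by (simp add: cadjoint[OF bounded, of "x - y"])
  then have "T (x - y) = 0"
    by (rule cinner_self_eq_zeroD)
  moreover obtain A where A: "bounded_operator A" "A \<circ> T = id"
    using left_inv unfolding left_invertible_def by blast
  ultimately have "x - y = 0"
    by (metis bounded_operatorD(4)[OF A(1)] comp_apply id_apply)
  then show ?thesis by simp
qed

text \<open>Taking adjoints in \<open>A T = I\<close> shows that \<open>Tadj\<close> is onto; it
  kills the orthogonal complement of the range of \<open>T\<close>, so a preimage can be projected
  into that range.\<close>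

lemma surj_TadjT: "\<exists>x. Tadj (T x) = y"
proof -
  obtain A where A: "bounded_operator A" "\<And>x. A (T x) = x"
    using left_inv unfolding left_invertible_def by (metis comp_apply id_apply)
  have "Tadj (cadjoint A y) = y"
    by (rule cinner_right_eqI) (simp add: A(2) flip: cadjoint[OF bounded] cadjoint[OF A(1)])
  define w where "w = cadjoint A y"
  \<comment> \<open>The range of \<open>T\<close> is the fixed set of the continuous map
    \<open>T A\<close>, hence closed.\<close>
  have range_eq: "range T = {x. T (A x) = x}"
    using A(2) by auto (metis rangeI)
  have "bounded_linear (\<lambda>x. T (A x))"
    by (rule bounded_linear_compose[OF bounded_operatorD(1)[OF bounded] bounded_operatorD(1)[OF A(1)]])
  then have "closed (range T)"
    unfolding range_eq by (intro closed_Collect_eq continuous_intros linear_continuous_on)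
  moreover have "subspace (range T)"
    by (intro linear_subspace_image subspace_UNIV bounded_linear.linear
        bounded_operatorD(1)[OF bounded])
  ultimately obtain p where p: "p \<in> range T" "\<And>s. s \<in> range T \<Longrightarrow> inner (w - p) s = 0"
    using orthogonal_projection_exists by blast
  then obtain x where x: "p = T x" by blast
  have "inner z (Tadj (w - p)) = 0" for z
  proof -
    have "inner z (Tadj (w - p)) = inner (T z) (w - p)"
      by (simp add: inner_eq_Re_cinner cadjoint[OF bounded])
    then show ?thesis using p(2) by (simp add: inner_commute)
  qed
  then have "Tadj (w - p) = 0" by (metis inner_eq_zero_iff)
  then have "Tadj (T x) = y"
    using \<open>Tadj (cadjoint A y) = y\<close> by (simp add: w_def x Tadj_diff)
  then show ?thesis by blast
qed

lemma Tadj_T_L: "Tadj (T (L x)) = Tadj x"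
proof -
  have "surj (Tadj \<circ> T)" using surj_TadjT by (metis comp_apply surj_def)
  from surj_f_inv_f[OF this] show ?thesis by (simp add: cdual_adj_def)
qed

text \<open>\<open>L x\<close> is the only solution of the normal equation, which spares further
  reasoning about \<open>inv\<close>.\<close>

lemma L_eqI: "Tadj (T y) = Tadj x \<Longrightarrow> L x = y"
  by (rule inj_TadjT) (simp add: Tadj_T_L)

lemma L_T [simp]: "L (T x) = x"
  by (rule L_eqI) simp

lemma L_add: "L (x + y) = L x + L y"
  by (rule L_eqI) (simp add: T_simps Tadj_add Tadj_T_L)

lemma L_scaleC: "L (a *\<^sub>C x) = a *\<^sub>C L x"
  by (rule L_eqI) (simp add: T_simps Tadj_scaleC Tadj_T_L)

lemma coker_iff: "x \<in> coker T \<longleftrightarrow> L x = 0"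
proof
  assume "x \<in> coker T"
  then show "L x = 0" by (intro L_eqI) (simp add: coker_def T_simps Tadj_zero)
next
  assume "L x = 0"
  then show "x \<in> coker T" using Tadj_T_L[of x] by (simp add: coker_def T_simps Tadj_zero)
qed

text \<open>\<open>T L\<close> projects orthogonally onto the range of \<open>T\<close>, whose
  complement is \<open>coker T\<close>. Two candidates for the value differ by a vector orthogonal
  to itself.\<close>

lemma P_eq: "P x = x - T (L x)"
  unfolding orth_proj_def
proof (rule the_equality)
  show "x - T (L x) \<in> coker T \<and> (\<forall>e\<in>coker T. cinner (x - (x - T (L x))) e = 0)"
    by (simp add: coker_orthogonal_range) (simp add: coker_def Tadj_diff Tadj_T_L)
next
  fix y assume y: "y \<in> coker T \<and> (\<forall>e\<in>coker T. cinner (x - y) e = 0)"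
  let ?d = "y - (x - T (L x))"
  have d: "?d \<in> coker T" using y by (simp add: coker_def Tadj_diff Tadj_T_L)
  have "?d = T (L x) - (x - y)" by simp
  then have "cinner ?d ?d = cinner (T (L x)) ?d - cinner (x - y) ?d"
    by (metis cinner_diff_left)
  also have "\<dots> = 0" using y d coker_orthogonal_range[OF d] by simp
  finally have "?d = 0"
    by (rule cinner_self_eq_zeroD)
  then show "y = x - T (L x)" by simp
qed

lemma P_in_coker: "P x \<in> coker T"
  unfolding P_eq by (simp add: coker_def Tadj_diff Tadj_T_L)

lemma P_T [simp]: "P (T x) = 0"
  by (simp add: P_eq)

lemma norm_T_L_le: "norm (T (L x)) \<le> norm x"
proof -
  have "inner (T (L x)) (P x) = 0"
    by (simp add: inner_eq_Re_cinner coker_orthogonal_range P_in_coker)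
  then have "inner (T (L x)) (T (L x)) = inner (T (L x)) x"
    by (simp add: P_eq inner_diff_right)
  then have "norm (T (L x)) * norm (T (L x)) \<le> norm (T (L x)) * norm x"
    using norm_cauchy_schwarz[of "T (L x)" x] by (simp add: dot_square_norm power2_eq_square)
  then show ?thesis by (cases "T (L x) = 0") auto
qed

text \<open>\<open>L = A T L\<close> for a left inverse \<open>A\<close>, and \<open>T L\<close>
  does not increase norms.\<close>

lemma bounded_operator_L: "bounded_operator L"
proof -
  obtain A where A: "bounded_operator A" "\<And>x. A (T x) = x"
    using left_inv unfolding left_invertible_def by (metis comp_apply id_apply)
  obtain K where K: "K \<ge> 0" "\<And>x. norm (A x) \<le> norm x * K"
    using bounded_linear.nonneg_bounded[OF bounded_operatorD(1)[OF A(1)]] by blast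
  have "norm (L x) \<le> norm x * K" for x
  proof -
    have "norm (L x) \<le> norm (T (L x)) * K" using K(2)[of "T (L x)"] by (simp add: A(2))
    also have "\<dots> \<le> norm x * K" using K(1) norm_T_L_le by (intro mult_right_mono)
    finally show ?thesis .
  qed
  then show ?thesis by (intro bounded_operatorI L_add L_scaleC)
qed

lemma bounded_operator_P: "bounded_operator P"
proof -
  have "bounded_linear (\<lambda>x. x - T (L x))"
    by (intro bounded_linear_sub bounded_linear_ident bounded_linear_compose[OF
          bounded_operatorD(1)[OF bounded] bounded_operatorD(1)[OF bounded_operator_L]])
  moreover have "P = (\<lambda>x. x - T (L x))" by (simp add: P_eq fun_eq_iff)
  ultimately show ?thesis
    by (simp add: bounded_operator_def T_simps L_scaleC scaleC_diff_right)
qed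

end

subsection \<open>Taylor coefficients and symbols\<close>

context left_invertible_operator
begin

text \<open>The Taylor coefficients of \<open>model_map T f\<close>, read off from \<open>f\<close>
  itself, so that most of the argument avoids analytic functions.\<close>

definition coeff :: "'a \<Rightarrow> nat \<Rightarrow> 'a" where
  "coeff f n = P ((L ^^ n) f)"

lemma bounded_operator_coeff: "bounded_operator (\<lambda>f. coeff f n)"
proof (induction n)
  case 0
  show ?case using bounded_operator_P by (simp add: coeff_def)
next
  case (Suc n)
  have "bounded_linear (\<lambda>f. coeff (L f) n)"
    by (rule bounded_linear_compose[OF bounded_operatorD(1)[OF Suc] bounded_operatorD(1)[OF bounded_operator_L]])
  moreover have "coeff f (Suc n) = coeff (L f) n" for f
    by (simp add: coeff_def funpow_swap1)
  ultimately show ?case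
    unfolding bounded_operator_def by (simp add: L_scaleC bounded_operatorD(5)[OF Suc])
qed

lemmas coeff_simps = bounded_operatorD(2-5)[OF bounded_operator_coeff]

lemma coeff_in_coker: "coeff f n \<in> coker T"
  by (simp only: coeff_def P_in_coker)

lemma coeff_L: "coeff (L f) n = coeff f (Suc n)"
  by (simp add: coeff_def funpow_swap1)

text \<open>\<open>L T = I\<close> and \<open>P T = 0\<close> make \<open>T\<close> the right shift
  on coefficient sequences.\<close>

lemma coeff_T_0 [simp]: "coeff (T f) 0 = 0"
  by (simp add: coeff_def)

lemma coeff_T_Suc [simp]: "coeff (T f) (Suc n) = coeff f n"
  by (simp flip: coeff_L)

lemma zero_in_coker: "0 \<in> coker T"
  by (simp add: coker_def Tadj_zero)

lemma add_in_coker: "x \<in> coker T \<Longrightarrow> y \<in> coker T \<Longrightarrow> x + y \<in> coker T"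
  by (simp add: coker_def Tadj_add)

lemma scaleC_in_coker: "x \<in> coker T \<Longrightarrow> c *\<^sub>C x \<in> coker T"
  by (simp add: coker_def Tadj_scaleC)

text \<open>If \<open>P\<close> kills \<open>(L ^^ n) f\<close>, then \<open>T L\<close> fixes it,
  so one more factor \<open>T\<close> can be pulled out at every stage.\<close>

lemma in_range_funpow_if_coeff_zero:
  assumes "\<And>n. coeff f n = 0"
  shows "f = (T ^^ n) ((L ^^ n) f)"
proof (induction n)
  case (Suc n)
  have "P ((L ^^ n) f) = 0" using assms[of n] by (simp only: coeff_def)
  then have "(L ^^ n) f = T (L ((L ^^ n) f))" by (simp add: P_eq)
  then have "(T ^^ n) ((L ^^ n) f) = (T ^^ Suc n) ((L ^^ Suc n) f)"
    by (metis comp_apply funpow.simps(2) funpow_swap1)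
  with Suc show ?case by (rule trans)
qed simp

lemma coeff_bound:
  obtains M K where "K > 0" "\<And>n. norm (coeff f n) \<le> M * K ^ n"
proof -
  obtain K where K: "K > 0" "\<And>x. norm (L x) \<le> norm x * K"
    using bounded_linear.pos_bounded[OF bounded_operatorD(1)[OF bounded_operator_L]] by blast
  obtain K' where K': "K' \<ge> 0" "\<And>x. norm (P x) \<le> norm x * K'"
    using bounded_linear.nonneg_bounded[OF bounded_operatorD(1)[OF bounded_operator_P]] by blast
  have L: "norm ((L ^^ n) f) \<le> norm f * K ^ n" for n
  proof (induction n)
    case (Suc n)
    then have "norm ((L ^^ n) f) * K \<le> norm f * K ^ n * K"
      using K(1) by (intro mult_right_mono) auto
    then show ?case using K(2)[of "(L ^^ n) f"] by (simp add: mult_ac)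
  qed simp
  have "norm (coeff f n) \<le> (norm f * K') * K ^ n" for n
    using K'(2)[of "(L ^^ n) f"] mult_right_mono[OF L[of n] K'(1)]
    by (simp add: coeff_def mult_ac)
  with K(1) show thesis by (rule that)
qed

text \<open>Geometric growth of the coefficients gives a positive radius of convergence; real
  arguments suffice for comparing coefficients in \<open>inj_model_map\<close>.\<close>

lemma coeff_series_summable:
  obtains s where "s > 0" "\<And>t::real. \<bar>t\<bar> < s \<Longrightarrow> summable (\<lambda>n. complex_of_real t ^ n *\<^sub>C coeff f n)"
proof -
  obtain M K where K: "K > 0" "\<And>n. norm (coeff f n) \<le> M * K ^ n"
    using coeff_bound by blast
  have "summable (\<lambda>n. complex_of_real t ^ n *\<^sub>C coeff f n)" if "\<bar>t\<bar> < 1 / K" for t :: real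
  proof (rule summable_comparison_test)
    have "norm (K * t) < 1" using that K(1) by (simp add: abs_mult field_simps)
    then have "norm (K * \<bar>t\<bar>) < 1" by (simp add: abs_mult)
    then show "summable (\<lambda>n. M * (K * \<bar>t\<bar>) ^ n)"
      by (intro summable_mult summable_geometric)
    have "norm (complex_of_real t ^ n *\<^sub>C coeff f n) \<le> M * (K * \<bar>t\<bar>) ^ n" for n
      using mult_left_mono[OF K(2)[of n], of "\<bar>t\<bar> ^ n"]
      by (simp add: norm_scaleC norm_power power_mult_distrib mult_ac)
    then show "\<exists>N. \<forall>n\<ge>N. norm (complex_of_real t ^ n *\<^sub>C coeff f n) \<le> M * (K * \<bar>t\<bar>) ^ n"
      by blast
  qed
  moreover have "1 / K > 0" using K by simp
  ultimately show thesis using that by blast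
qed

section \<open>Convolution with operator-valued sequences\<close>

lemma cauchy_conv_add:
  assumes "\<And>n. \<phi> n \<in> bounded_operators_on (coker T)"
  shows "cauchy_conv \<phi> (coeff (f + g)) n = cauchy_conv \<phi> (coeff f) n + cauchy_conv \<phi> (coeff g) n"
proof -
  have "\<phi> k (x + y) = \<phi> k x + \<phi> k y" if "x \<in> coker T" "y \<in> coker T" for k x y
    using assms that by (auto simp: bounded_operators_on_def)
  then show ?thesis
    by (simp add: cauchy_conv_def coeff_simps coeff_in_coker sum.distrib)
qed

lemma cauchy_conv_scaleC:
  assumes "\<And>n. \<phi> n \<in> bounded_operators_on (coker T)"
  shows "cauchy_conv \<phi> (coeff (c *\<^sub>C f)) n = c *\<^sub>C cauchy_conv \<phi> (coeff f) n"
proof -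
  have "\<phi> k (c *\<^sub>C x) = c *\<^sub>C \<phi> k x" if "x \<in> coker T" for k x
    using assms that by (auto simp: bounded_operators_on_def)
  then show ?thesis
    by (simp add: cauchy_conv_def coeff_simps coeff_in_coker scaleC_sum)
qed

lemma bounded_linear_cauchy_conv:
  assumes \<phi>: "\<And>n. \<phi> n \<in> bounded_operators_on (coker T)"
  shows "bounded_linear (\<lambda>f. cauchy_conv \<phi> (coeff f) n)"
  unfolding cauchy_conv_def
proof (rule bounded_linear_sum)
  fix k
  have add: "\<phi> k (x + y) = \<phi> k x + \<phi> k y" if "x \<in> coker T" "y \<in> coker T" for x y
    using \<phi> that by (auto simp: bounded_operators_on_def)
  have scale: "\<phi> k (c *\<^sub>C x) = c *\<^sub>C \<phi> k x" if "x \<in> coker T" for c x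
    using \<phi> that by (auto simp: bounded_operators_on_def)
  obtain K where K: "\<forall>x\<in>coker T. norm (\<phi> k x) \<le> K * norm x"
    using \<phi>[of k] unfolding bounded_operators_on_def by blast
  obtain M where M: "\<And>f. norm (coeff f (n - k)) \<le> norm f * M"
    using bounded_linear.nonneg_bounded[OF bounded_operatorD(1)[OF bounded_operator_coeff]] by blast
  show "bounded_linear (\<lambda>f. \<phi> k (coeff f (n - k)))"
  proof (rule bounded_linear_intro)
    fix f
    have "norm (\<phi> k (coeff f (n - k))) \<le> K * norm (coeff f (n - k))"
      by (rule bspec[OF K coeff_in_coker])
    \<comment> \<open>The sign of the constant in \<open>bounded_operators_on\<close> is not
      prescribed, hence the absolute value.\<close>
    also have "\<dots> \<le> \<bar>K\<bar> * norm (coeff f (n - k))"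
      by (intro mult_right_mono) auto
    also have "\<dots> \<le> \<bar>K\<bar> * (norm f * M)" by (intro mult_left_mono M) auto
    finally show "norm (\<phi> k (coeff f (n - k))) \<le> norm f * (\<bar>K\<bar> * M)" by (simp add: mult_ac)
  qed (simp_all add: coeff_simps add scale coeff_in_coker scaleR_eq_scaleC)
qed

lemma cauchy_conv_coeff_T:
  assumes "\<And>n. \<phi> n \<in> bounded_operators_on (coker T)"
  shows "cauchy_conv \<phi> (coeff (T f)) 0 = 0"
    and "cauchy_conv \<phi> (coeff (T f)) (Suc n) = cauchy_conv \<phi> (coeff f) n"
proof -
  \<comment> \<open>Linearity of \<open>\<phi> k\<close> is known only on \<open>coker T\<close>;
    homogeneity there with scalar 0 yields \<open>\<phi> k 0 = 0\<close>.\<close>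
  have "\<phi> k (0 *\<^sub>C 0) = 0 *\<^sub>C \<phi> k 0" for k
    using assms[of k] zero_in_coker unfolding bounded_operators_on_def by blast
  then have [simp]: "\<phi> k 0 = 0" for k by simp
  show "cauchy_conv \<phi> (coeff (T f)) 0 = 0"
    by (simp add: cauchy_conv_def)
  \<comment> \<open>The last summand, \<open>k = Suc n\<close>, meets the zeroth coefficient of
    \<open>T f\<close>, which is 0.\<close>
  show "cauchy_conv \<phi> (coeff (T f)) (Suc n) = cauchy_conv \<phi> (coeff f) n"
    by (simp add: cauchy_conv_def Suc_diff_le)
qed

text \<open>Vectors of \<open>coker T\<close> are the constants of the model, and the symbol records
  the action of \<open>A\<close> on them. The restriction supplies the extensional
  representative.\<close>

definition symbol :: "('a \<Rightarrow> 'a) \<Rightarrow> nat \<Rightarrow> 'a \<Rightarrow> 'a" where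
  "symbol A n = (\<lambda>e\<in>coker T. coeff (A e) n)"

lemma symbol_in_bounded_operators_on:
  assumes A: "bounded_operator A"
  shows "symbol A n \<in> bounded_operators_on (coker T)"
proof -
  obtain K where K: "\<And>x. norm (coeff (A x) n) \<le> norm x * K"
    using bounded_linear.nonneg_bounded[OF bounded_linear_compose[OF
          bounded_operatorD(1)[OF bounded_operator_coeff] bounded_operatorD(1)[OF A]]] by blast
  then have "\<exists>K. \<forall>x\<in>coker T. norm (symbol A n x) \<le> K * norm x"
    by (intro exI[of _ K]) (simp add: symbol_def mult.commute)
  then show ?thesis
    unfolding bounded_operators_on_def
    by (simp add: symbol_def coeff_in_coker add_in_coker scaleC_in_coker coeff_simps
        bounded_operatorD[OF A])
qed

lemma cauchy_conv_symbol:
  assumes A: "bounded_operator A" and comm: "\<And>x. A (T x) = T (A x)"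
  shows "cauchy_conv (symbol A) (coeff f) n = coeff (A f) n"
proof -
  have decomp: "A f = A (coeff f 0) + T (A (L f))" for f
    by (simp add: coeff_def P_eq bounded_operatorD[OF A] comm)
  show ?thesis
  \<comment> \<open>\<open>f\<close> must vary because the step passes to
    \<open>L f\<close>.\<close>
  proof (induction n arbitrary: f)
    case 0
    have "coeff (A f) 0 = coeff (A (coeff f 0)) 0"
      using arg_cong[OF decomp[of f], of "\<lambda>x. coeff x 0"] by (simp only: coeff_simps coeff_T_0 add_0_right)
    then show ?case
      by (simp add: cauchy_conv_def symbol_def coeff_in_coker)
    next
    case (Suc n)
    have "coeff (A f) (Suc n) = coeff (A (coeff f 0)) (Suc n) + coeff (A (L f)) n"
      using arg_cong[OF decomp[of f], of "\<lambda>x. coeff x (Suc n)"] by (simp only: coeff_simps coeff_T_Suc)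
    also have "coeff (A (L f)) n = cauchy_conv (symbol A) (coeff (L f)) n"
      by (rule Suc.IH[symmetric])
    \<comment> \<open>The summand \<open>k = Suc n\<close> acts on \<open>coeff f 0\<close>; the
      others form the convolution for \<open>L f\<close>.\<close>
    finally show ?case
      by (simp add: cauchy_conv_def coeff_L Suc_diff_le symbol_def coeff_in_coker add.commute)
  qed
qed

end

subsection \<open>The model of an analytic left-invertible operator\<close>

locale analytic_left_invertible_operator = left_invertible_operator +
  assumes nonzero: "\<exists>x::'a. x \<noteq> 0"
    and analytic: "analytic_operator T"
begin

text \<open>Analyticity enters here: a vector with all coefficients zero lies in the range of every
  power of \<open>T\<close>.\<close>

lemma coeff_eq_imp_eq:
  assumes "\<And>n. coeff f n = coeff g n"
  shows "f = g"
proof -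
  have "coeff (f - g) n = 0" for n by (simp add: coeff_simps assms)
  then have "f - g \<in> range (T ^^ n)" for n
    using in_range_funpow_if_coeff_zero[of "f - g" n] by (metis rangeI)
  then have "f - g \<in> (\<Inter>n. range (T ^^ n))" by blast
  then have "f - g = 0" using analytic unfolding analytic_operator_def by blast
  then show ?thesis by simp
qed

text \<open>If \<open>coker T\<close> were trivial, all coefficients would vanish and all vectors
  would coincide.\<close>

lemma coker_nonzero: obtains e where "e \<in> coker T" "e \<noteq> 0"
proof (rule ccontr)
  assume "\<not> thesis"
  then have "P x = 0" for x using that P_in_coker by blast
  then have "coeff f n = coeff g n" for f g n by (simp only: coeff_def)
  then have "f = g" for f g :: 'a by (rule coeff_eq_imp_eq)
  then show False using nonzero by metis
qed

text \<open>The nonzero spectrum of \<open>L\<close> contains eigenvalues: if \<open>e \<in> ker T\<^sup>*\<close> and \<open>c x - T x = e\<close>, then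
  applying \<open>L\<close> gives \<open>c L x = x\<close>. Hence \<open>r(L) > 0\<close>, so that the disc of the model is not empty.\<close>

lemma op_spectral_radius_pos: "op_spectral_radius L > 0"
proof -
  obtain K where K: "0 \<le> K" "\<And>x. norm (T x) \<le> norm x * K"
    using bounded_linear.nonneg_bounded[OF bounded_operatorD(1)[OF bounded]] by blast
  \<comment> \<open>\<open>K + 1\<close> exceeds the bound \<open>K\<close> for \<open>T\<close>, so
    \<open>c - T\<close> is bijective.\<close>
  define c where "c = complex_of_real (K + 1)"
  have "cmod c = K + 1" using K(1) unfolding c_def by (simp only: norm_of_real)
  then have c: "K < cmod c" "c \<noteq> 0" using K(1) by auto
  obtain e where e: "e \<in> coker T" "e \<noteq> 0" by (rule coker_nonzero)
  obtain x where x: "c *\<^sub>C x - T x = e"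
    using resolvent_equation_unique_solution[OF bounded K(2,1) c(1)] by blast
  then have "x \<noteq> 0" using e(2) T_simps(3) by auto
  have "c *\<^sub>C L x - x = L e"
    by (simp add: bounded_operatorD[OF bounded_operator_L] flip: x)
  then have "c *\<^sub>C L x = x" using e(1) by (simp add: coker_iff)
  then have "inverse c *\<^sub>C x = inverse c *\<^sub>C c *\<^sub>C L x" by simp
  then have eigen: "inverse c *\<^sub>C x - L x = 0" using c(2) by (simp add: scaleC_scaleC)
  \<comment> \<open>A nonzero vector in the kernel of \<open>inverse c - L\<close> rules out a left
    inverse.\<close>
  have "\<not> (\<forall>y. B (inverse c *\<^sub>C y - L y) = y)" if "bounded_operator B" for B
    using eigen \<open>x \<noteq> 0\<close> bounded_operatorD(4)[OF that] by metis
  then have "inverse c \<in> op_spectrum L"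
    unfolding op_spectrum_def by blast
  moreover obtain M where "0 \<le> M" "\<And>x. norm (L x) \<le> norm x * M"
    using bounded_linear.nonneg_bounded[OF bounded_operatorD(1)[OF bounded_operator_L]] by blast
  then have "bdd_above (cmod ` op_spectrum L)"
    using norm_le_if_in_op_spectrum[OF bounded_operator_L] by (intro bdd_aboveI2) blast
  ultimately have "cmod (inverse c) \<le> op_spectral_radius L"
    unfolding op_spectral_radius_def by (intro cSUP_upper)
  moreover have "cmod (inverse c) > 0" using c(2) by simp
  ultimately show ?thesis by linarith
qed

lemma inj_model_map: "inj (model_map T)"
proof (rule injI)
  fix f g assume eq: "model_map T f = model_map T g"
  obtain s where s: "s > 0"
    "\<And>t::real. \<bar>t\<bar> < s \<Longrightarrow> summable (\<lambda>n. complex_of_real t ^ n *\<^sub>C coeff f n)"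
    using coeff_series_summable by blast
  obtain s' where s': "s' > 0"
    "\<And>t::real. \<bar>t\<bar> < s' \<Longrightarrow> summable (\<lambda>n. complex_of_real t ^ n *\<^sub>C coeff g n)"
    using coeff_series_summable by blast
  \<comment> \<open>Within this radius the argument lies in the disc and both series converge, so
    that \<open>suminf\<close> is their true sum.\<close>
  define r where "r = min (model_radius T) (min s s')"
  \<comment> \<open>A spectral radius 0 would make \<open>model_radius T\<close> equal to
    \<open>1 / 0 = 0\<close> and the disc empty.\<close>
  have r: "r > 0" using s(1) s'(1) op_spectral_radius_pos by (simp add: r_def model_radius_def)
  \<comment> \<open>Pairing with \<open>v\<close> reduces the vector series to a real power
    series.\<close>
  have "inner (coeff f n - coeff g n) v = 0" for n v
  proof (rule powser_sums_zero_imp_coeff_zero[OF r])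
    fix t :: real assume "norm t < r"
    then have t: "complex_of_real t \<in> ball 0 (model_radius T)" "\<bar>t\<bar> < s" "\<bar>t\<bar> < s'"
      by (auto simp: r_def)
    have "model_map T h (complex_of_real t) = (\<Sum>n. complex_of_real t ^ n *\<^sub>C coeff h n)" for h
      using t(1) by (simp add: model_map_def coeff_def)
    then have sum_eq: "(\<Sum>n. complex_of_real t ^ n *\<^sub>C coeff f n)
        = (\<Sum>n. complex_of_real t ^ n *\<^sub>C coeff g n)"
      using fun_cong[OF eq, of "complex_of_real t"] by simp
    have "(\<lambda>n. complex_of_real t ^ n *\<^sub>C coeff f n - complex_of_real t ^ n *\<^sub>C coeff g n) sums 0"
      using sums_diff[OF summable_sums[OF s(2)[OF t(2)]] summable_sums[OF s'(2)[OF t(3)]]]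
      by (simp add: sum_eq)
    moreover have "complex_of_real t ^ n *\<^sub>C coeff f n - complex_of_real t ^ n *\<^sub>C coeff g n
        = t ^ n *\<^sub>R (coeff f n - coeff g n)" for n
      by (simp add: scaleR_eq_scaleC scaleC_diff_right)
    ultimately have "(\<lambda>n. t ^ n *\<^sub>R (coeff f n - coeff g n)) sums 0" by simp
    from bounded_linear.sums[OF bounded_linear_inner_left this, of v]
    show "(\<lambda>n. inner (coeff f n - coeff g n) v * t ^ n) sums 0"
      by (simp add: mult.commute)
  qed
  then have "coeff f n - coeff g n = 0" for n by (metis inner_eq_zero_iff)
  then have "coeff f n = coeff g n" for n by simp
  then show "f = g" by (rule coeff_eq_imp_eq)
qed

text \<open>The inner product of the model is transported by \<open>model_map T\<close>, so its
  adjoint is its inverse.\<close>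

lemma model_map_adj_model_map [simp]: "model_map_adj T (model_map T f) = f"
  unfolding model_map_adj_def model_cinner_def inv_f_f[OF inj_model_map]
proof (rule the_equality)
  fix g assume "\<forall>h. cinner h g = cinner h f"
  then have "cinner h g = cinner h f" for h by blast
  then show "g = f" by (rule cinner_right_eqI)
qed simp

lemma taylor_coeff_model_map [simp]: "taylor_coeff T (model_map T f) = coeff f"
  by (simp add: taylor_coeff_def coeff_def fun_eq_iff)

lemma model_map_in_model_space [simp]: "model_map T f \<in> model_space T"
  by (simp add: model_space_def)

text \<open>Serves both inclusions: a map \<open>A\<close> that realises the convolution on
  coefficients turns the multiplication operator into \<open>U A U*\<close>.\<close>

lemma mult_op_eq:
  assumes conv: "\<And>f. cauchy_conv \<phi> (coeff f) = coeff (A f)"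
  shows "mult_dom T \<phi> = model_space T"
    and "mult_op T \<phi> = (\<lambda>f\<in>model_space T. model_map T (A (model_map_adj T f)))"
proof -
  show dom: "mult_dom T \<phi> = model_space T"
    unfolding mult_dom_def by (auto simp: model_space_def conv)
  have "(THE g. g \<in> model_space T \<and> cauchy_conv \<phi> (taylor_coeff T (model_map T f)) = taylor_coeff T g)
      = model_map T (A f)" for f
  proof (rule the_equality)
    fix g assume g: "g \<in> model_space T \<and> cauchy_conv \<phi> (taylor_coeff T (model_map T f)) = taylor_coeff T g"
    then obtain h where h: "g = model_map T h" by (auto simp: model_space_def)
    then have "coeff h = coeff (A f)" using g by (simp add: conv)
    then have "coeff h n = coeff (A f) n" for n by simp
    then have "h = A f" by (rule coeff_eq_imp_eq)
    then show "g = model_map T (A f)" by (simp add: h)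
  qed (simp add: conv)
  then show "mult_op T \<phi> = (\<lambda>f\<in>model_space T. model_map T (A (model_map_adj T f)))"
    unfolding mult_op_def dom by (intro restrict_ext) (auto simp: model_space_def)
qed

section \<open>The two inclusions\<close>

lemma commutant_to_multiplier:
  assumes "A \<in> commutant T"
  obtains \<phi> where "\<phi> \<in> gen_multipliers T"
    "mult_op T \<phi> = (\<lambda>f\<in>model_space T. model_map T (A (model_map_adj T f)))"
proof -
  have A: "bounded_operator A" "\<And>x. A (T x) = T (A x)"
    using assms by (auto simp: commutant_def fun_eq_iff)
  have conv: "cauchy_conv (symbol A) (coeff f) = coeff (A f)" for f
    using cauchy_conv_symbol[OF A] by blast
  have "symbol A \<in> gen_multipliers T"
    unfolding gen_multipliers_def
    by (simp add: symbol_in_bounded_operators_on[OF A(1)] mult_op_eq(1)[OF conv])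
  then show thesis using mult_op_eq(2)[OF conv] by (rule that)
qed

lemma multiplier_to_commutant:
  assumes "\<phi> \<in> gen_multipliers T"
  obtains A where "A \<in> commutant T"
    "mult_op T \<phi> = (\<lambda>f\<in>model_space T. model_map T (A (model_map_adj T f)))"
proof -
  have \<phi>: "\<And>n. \<phi> n \<in> bounded_operators_on (coker T)"
    and dom: "mult_dom T \<phi> = model_space T"
    using assms by (auto simp: gen_multipliers_def)
  have "\<exists>g. cauchy_conv \<phi> (coeff f) = coeff g" for f
  proof -
    have "model_map T f \<in> mult_dom T \<phi>" by (simp add: dom)
    then show ?thesis by (auto simp: mult_dom_def model_space_def)
  qed
  \<comment> \<open>A value is chosen for each \<open>f\<close>; coefficients determine it, so
    linearity can be checked on them.\<close>
  then obtain A where conv: "\<And>f. cauchy_conv \<phi> (coeff f) = coeff (A f)" by metis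
  have add: "A (f + g) = A f + A g" for f g
    by (rule coeff_eq_imp_eq) (simp add: cauchy_conv_add[OF \<phi>] coeff_simps flip: conv)
  have scale: "A (c *\<^sub>C f) = c *\<^sub>C A f" for c f
    by (rule coeff_eq_imp_eq) (simp add: cauchy_conv_scaleC[OF \<phi>] coeff_simps flip: conv)
  have "bounded_linear A"
  \<comment> \<open>The coefficient maps are the separating family.\<close>
  proof (rule bounded_linear_if_separating_compositions_bounded)
    show "linear A" by (rule linearI) (simp_all add: add scale scaleR_eq_scaleC)
    show "bounded_linear (\<lambda>w. coeff w n)" for n
      by (rule bounded_operatorD(1)[OF bounded_operator_coeff])
    show "bounded_linear (\<lambda>f. coeff (A f) n)" for n
      using bounded_linear_cauchy_conv[of \<phi> n, OF \<phi>] by (simp add: conv)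
    show "w = 0" if "\<And>n. coeff w n = 0" for w
      by (rule coeff_eq_imp_eq) (simp add: that coeff_simps)
  qed
  moreover have "A (T f) = T (A f)" for f
  proof (rule coeff_eq_imp_eq)
    \<comment> \<open>Both sides are the right shift of the coefficients of \<open>A f\<close>, with
      0 in position 0.\<close>
    show "coeff (A (T f)) n = coeff (T (A f)) n" for n
      using cauchy_conv_coeff_T[of \<phi> f, OF \<phi>] by (cases n) (simp_all add: conv)
  qed
  ultimately have "A \<in> commutant T"
    by (auto simp: commutant_def bounded_operator_def scale)
  then show thesis using mult_op_eq(2)[OF conv] by (rule that)
qed

end

theorem corollary5:
  fixes T :: "'a::complex_hilbert \<Rightarrow> 'a"
  assumes nonzero: "\<exists>x::'a. x \<noteq> 0"
    and bounded: "bounded_operator T"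
    and left_inv: "left_invertible T"
    and analytic: "analytic_operator T"
  shows "{(\<lambda>f\<in>model_space T. model_map T (A (model_map_adj T f))) | A. A \<in> commutant T}
       = {mult_op T \<phi> | \<phi>. \<phi> \<in> gen_multipliers T}"
proof -
  interpret analytic_left_invertible_operator T
    by unfold_locales fact+
  show ?thesis
  proof (intro subset_antisym subsetI)
    fix M assume "M \<in> {(\<lambda>f\<in>model_space T. model_map T (A (model_map_adj T f))) | A. A \<in> commutant T}"
    then obtain A where A: "A \<in> commutant T"
      "M = (\<lambda>f\<in>model_space T. model_map T (A (model_map_adj T f)))" by blast
    obtain \<phi> where "\<phi> \<in> gen_multipliers T" "mult_op T \<phi> = M"
      using commutant_to_multiplier[OF A(1)] unfolding A(2) by blast
    then show "M \<in> {mult_op T \<phi> | \<phi>. \<phi> \<in> gen_multipliers T}" by blast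
  next
    fix M assume "M \<in> {mult_op T \<phi> | \<phi>. \<phi> \<in> gen_multipliers T}"
    then obtain \<phi> where \<phi>: "\<phi> \<in> gen_multipliers T" "M = mult_op T \<phi>" by blast
    obtain A where "A \<in> commutant T"
      "M = (\<lambda>f\<in>model_space T. model_map T (A (model_map_adj T f)))"
      using multiplier_to_commutant[OF \<phi>(1)] unfolding \<phi>(2) by blast
    then show "M \<in> {(\<lambda>f\<in>model_space T. model_map T (A (model_map_adj T f))) | A. A \<in> commutant T}"
      by blast
  qed
qed

end
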